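(* Let $\mathcal{D}=\{X\in\mathcal{S}^n:\ X=\operatorname{Diag}(\operatorname{diag}(X)),\ \operatorname{rank}(X)\le k,\ f(\operatorname{diag}(X))\le0\}$, let $\tilde k\le k$ be its strengthened rank, and for $s\in[\tilde k+1]$ let $$\hat{\mathcal{Y}}^s:=\{X\in\mathcal{S}^n:\ X=\operatorname{Diag}(\operatorname{diag}(X)),\ \exists x\in\mathbb{R}^n,\ f(x)\le0,\ x_1\ge\cdots\ge x_n,\ x_s=x_{s+n-\tilde k-1}=0,\ x\succeq\operatorname{diag}(X)\}.$$ Consider $$V_{\rm rel\text{-}I}:=\min_{s\in[\tilde k+1]}\ \min_{X\in\hat{\mathcal{Y}}^s}\{\langle A_0,X\rangle:\ b_i^l\le\langle A_i,X\rangle\le b_i^u,\ \forall i\in[m]\}\qquad\text{(LSOP-R-I)},$$ and let $\tilde m$ be the number of linearly independent matrices among $A_1,\dots,A_m$. Suppose that the inner minimization of LSOP-R-I always (for every $s\in[\tilde k+1]$) admits a feasible set containing no line. Then: (i) for every $s\in[\tilde k+1]$, every extreme point of the feasible set of the $s$th inner minimization has rank at most $\tilde k+\tilde m$; and (ii) there is an optimal solution to LSOP-R-I of rank at most $\tilde k+\tilde m$ if LSOP-R-I yields a finite optimal value, i.e., $V_{\rm rel\text{-}I}>-\infty$.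
   Context: $k\le n$ are positive integers; $[m]=\{1,\dots,m\}$; $\mathcal{S}^n$ is the space of $n\times n$ real symmetric matrices; $\operatorname{diag}(X)\in\mathbb{R}^n$ is the vector of diagonal entries of $X$, and $\operatorname{Diag}(x)$ is the diagonal matrix with diagonal $x$ (so $X=\operatorname{Diag}(\operatorname{diag}(X))$ says $X$ is diagonal). $\langle\cdot,\cdot\rangle$ is the Frobenius inner product; $\operatorname{conv}$ denotes convex hull. The function $f:\mathbb{R}^n\to\mathbb{R}$ is continuous, convex and symmetric (invariant under permutations of its arguments). $A_0,A_1,\dots,A_m\in\mathcal{S}^n$ and $-\infty\le b_i^l\le b_i^u\le+\infty$. The number $\tilde m$ is the dimension of the linear span of $\{A_i\}_{i\in[m]}$. Majorization: $x\succeq y$ for $x,y\in\mathbb{R}^n$ means that for every $\ell\in[n]$ the sum of the $\ell$ largest entries of $x$ is at least the sum of the $\ell$ largest entries of $y$, and $\sum_i x_i=\sum_i y_i$. Strengthened rank: $\tilde k$ with $1\le\tilde k\le k$ is the smallest integer such that $\operatorname{conv}(\mathcal{D})=\operatorname{conv}(\{X\in\mathcal{S}^n:\ X \text{ diagonal},\ \operatorname{rank}(X)\le\tilde k,\ f(\operatorname{diag}(X))\le0\})$.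
   Formalization: In (ii), "finite optimal value" is taken to mean V_rel-I > -∞ and the overall minimum is attained, since a finite infimum need not be attained and (ii) then fails; for k̃ = n the condition x_s = x_{s+n-k̃-1} = 0, whose indices can leave [n], is dropped. *)

theory Defs
  imports "HOL-Analysis.Analysis"
begin

text \<open>
  Vectors in $R^n$ and $n \times n$ matrices are indexed by an arbitrary finite linearly ordered
  type \<open>'n\<close> with \<open>n = CARD('n)\<close>; the order supplies the enumeration
  $x_1, \dots, x_n$ of the entries of a vector.
\<close>

definition entries :: "real ^ 'n::{finite,linorder} \<Rightarrow> real list"
  where "entries x = map (\<lambda>i. x $ i) (sorted_list_of_set UNIV)"

(* 1-based: meaningful only for 1 \<le> j \<le> CARD('n) *)
definition entry :: "real ^ 'n::{finite,linorder} \<Rightarrow> nat \<Rightarrow> real"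
  where "entry x j = entries x ! (j - 1)"

definition sum_largest :: "nat \<Rightarrow> real ^ 'n::{finite,linorder} \<Rightarrow> real"
  where "sum_largest l x = sum_list (take l (rev (sort (entries x))))"

definition majorizes :: "real ^ 'n::{finite,linorder} \<Rightarrow> real ^ 'n::{finite,linorder} \<Rightarrow> bool"
  where "majorizes x y \<longleftrightarrow>
    (\<forall>l\<in>{1..CARD('n)}. sum_largest l y \<le> sum_largest l x) \<and>
    (\<Sum>i\<in>UNIV. x $ i) = (\<Sum>i\<in>UNIV. y $ i)"

definition symmetric_fun :: "(real ^ 'n \<Rightarrow> real) \<Rightarrow> bool"
  where "symmetric_fun f \<longleftrightarrow> (\<forall>p x. p permutes UNIV \<longrightarrow> f (\<chi> i. x $ p i) = f x)"

definition sym_matrices :: "(real ^ 'n ^ 'n) set"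
  where "sym_matrices = {X. transpose X = X}"

definition diag_vec :: "real ^ 'n ^ 'n \<Rightarrow> real ^ 'n"
  where "diag_vec X = (\<chi> i. X $ i $ i)"

definition Diag :: "real ^ 'n \<Rightarrow> real ^ 'n ^ 'n"
  where "Diag x = (\<chi> i j. if i = j then x $ i else 0)"

definition diag_domain :: "(real ^ 'n \<Rightarrow> real) \<Rightarrow> nat \<Rightarrow> (real ^ 'n ^ 'n) set"
  where "diag_domain f k =
    {X \<in> sym_matrices. X = Diag (diag_vec X) \<and> rank X \<le> k \<and> f (diag_vec X) \<le> 0}"

definition strengthened_rank :: "(real ^ 'n \<Rightarrow> real) \<Rightarrow> nat \<Rightarrow> nat"
  where "strengthened_rank f k =
    (LEAST r. 1 \<le> r \<and> r \<le> k \<and> convex hull (diag_domain f k) = convex hull (diag_domain f r))"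

text \<open>
  In the following definition \<open>r\<close> is the strengthened rank.  The positions from \<open>s\<close> to
  \<open>s + n - r - 1\<close>, on which the sorted vector is required to vanish, form a window of length
  \<open>n - r\<close>, and the two end points suffice since the vector is sorted.  For \<open>r = n\<close>
  the window is empty (its end points cross, and for \<open>s = 1\<close> and \<open>s = n + 1\<close> one of
  them is not a position at all), so no entry is constrained.
\<close>

definition Y_hat ::
    "(real ^ 'n::{finite,linorder} \<Rightarrow> real) \<Rightarrow> nat \<Rightarrow> nat \<Rightarrow> (real ^ 'n::{finite,linorder} ^ 'n::{finite,linorder}) set"
  where "Y_hat f r s =
    {X \<in> sym_matrices. X = Diag (diag_vec X) \<and>
      (\<exists>x. f x \<le> 0 \<and>
           (\<forall>j\<in>{1..<CARD('n)}. entry x (j + 1) \<le> entry x j) \<and>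
           (r < CARD('n) \<longrightarrow> entry x s = 0 \<and> entry x (s + CARD('n) - r - 1) = 0) \<and>
           majorizes x (diag_vec X))}"

definition feasible_set ::
    "(real ^ 'n::{finite,linorder} \<Rightarrow> real) \<Rightarrow> nat \<Rightarrow> nat \<Rightarrow> (nat \<Rightarrow> real ^ 'n::{finite,linorder} ^ 'n::{finite,linorder})
      \<Rightarrow> (nat \<Rightarrow> ereal) \<Rightarrow> (nat \<Rightarrow> ereal) \<Rightarrow> nat \<Rightarrow> (real ^ 'n::{finite,linorder} ^ 'n::{finite,linorder}) set"
  where "feasible_set f r m A bl bu s =
    {X \<in> Y_hat f r s. \<forall>i\<in>{1..m}. bl i \<le> ereal (A i \<bullet> X) \<and> ereal (A i \<bullet> X) \<le> bu i}"

(* an infeasible problem has value \<infinity>; \<bullet> on matrices is the Frobenius inner product *)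
definition V_rel_I ::
    "(real ^ 'n::{finite,linorder} \<Rightarrow> real) \<Rightarrow> nat \<Rightarrow> nat \<Rightarrow> (nat \<Rightarrow> real ^ 'n::{finite,linorder} ^ 'n::{finite,linorder})
      \<Rightarrow> (nat \<Rightarrow> ereal) \<Rightarrow> (nat \<Rightarrow> ereal) \<Rightarrow> ereal"
  where "V_rel_I f r m A bl bu =
    (INF s\<in>{1..r+1}. INF X\<in>feasible_set f r m A bl bu s. ereal (A 0 \<bullet> X))"

definition optimal_solution ::
    "(real ^ 'n::{finite,linorder} \<Rightarrow> real) \<Rightarrow> nat \<Rightarrow> nat \<Rightarrow> (nat \<Rightarrow> real ^ 'n::{finite,linorder} ^ 'n::{finite,linorder})
      \<Rightarrow> (nat \<Rightarrow> ereal) \<Rightarrow> (nat \<Rightarrow> ereal) \<Rightarrow> real ^ 'n::{finite,linorder} ^ 'n::{finite,linorder} \<Rightarrow> bool"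
  where "optimal_solution f r m A bl bu X \<longleftrightarrow>
    (\<exists>s\<in>{1..r+1}. X \<in> feasible_set f r m A bl bu s) \<and>
    ereal (A 0 \<bullet> X) = V_rel_I f r m A bl bu"

text \<open>
  The value is written as a minimum, so a finite optimal value is one that is attained.  With an
  infimum in place of the minimum, finiteness alone does not provide any optimal solution: for
  \<open>n = 3\<close>, \<open>k = 2\<close>, \<open>m = 0\<close> and $f(x) = \max(-x_1, -x_2, -x_3,
  \sqrt{\|x\|^2 + 2} - x_1 - x_2 - x_3)$ the strengthened rank is 2, the feasible sets contain no
  line, and $\langle A_0, X \rangle = X_{22} + X_{33}$ has infimum 0, which is not attained.
\<close>

definition finite_optimal_value ::
    "(real ^ 'n::{finite,linorder} \<Rightarrow> real) \<Rightarrow> nat \<Rightarrow> nat \<Rightarrow> (nat \<Rightarrow> real ^ 'n::{finite,linorder} ^ 'n::{finite,linorder})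
      \<Rightarrow> (nat \<Rightarrow> ereal) \<Rightarrow> (nat \<Rightarrow> ereal) \<Rightarrow> bool"
  where "finite_optimal_value f r m A bl bu \<longleftrightarrow>
    V_rel_I f r m A bl bu > -\<infinity> \<and>
    (\<exists>X. optimal_solution f r m A bl bu X)"

definition contains_no_line :: "'a::real_vector set \<Rightarrow> bool"
  where "contains_no_line S \<longleftrightarrow> \<not> (\<exists>a d. d \<noteq> 0 \<and> (\<forall>t::real. a + t *\<^sub>R d \<in> S))"

end

theory Submission
  imports Defs
begin

text \<open>
  Let \<open>X = Diag y\<close> be feasible, with \<open>x\<close> a sorted vector that majorizes \<open>y\<close> and vanishes on
  a window of \<open>n - r\<close> positions, where \<open>r\<close> is the strengthened rank.  Keep \<open>x\<close> fixed.  The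
  vectors majorized by \<open>x\<close> then form a polytope, and the point is to show that \<open>y\<close> lies in the
  relative interior of one of its faces whose dimension is at least \<open>p - r\<close>, where \<open>p\<close> is the
  number of nonzero entries of \<open>y\<close>, that is, the rank of \<open>X\<close>.  If \<open>p\<close> exceeds
  \<open>r + mt\<close>, this face contains a segment around \<open>y\<close> along which all \<open>\<langle>A i, Diag y\<rangle>\<close>
  are constant, and such a segment consists of feasible points.

  The polytope is given by the inequalities \<open>(\<Sum>i\<in>S. y $ i) \<le> g (card S)\<close>, where \<open>g l\<close> is the sum
  of the first \<open>l\<close> entries of \<open>x\<close>, and by the prescribed total (\<open>majorizes_iff_subset_sums\<close>).
  As \<open>g\<close> is concave, the sets \<open>S\<close> with equality form a lattice, whose indicator vectors are
  spanned by one for each cardinality (\<open>lattice_ind_span\<close>).  The zeros of \<open>x\<close> make \<open>g\<close>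
  constant, and maximal, on \<open>n - r + 1\<close> consecutive cardinalities.  All tight sets with such a
  cardinality have the same indicator vector up to the coordinates where \<open>y\<close> is zero.  Hence
  the tight sets span at most \<open>r + (n - p)\<close> dimensions (\<open>dim_tight_sets_le\<close>), which leaves
  \<open>p - r\<close> dimensions of free directions (\<open>majorized_perturbation\<close>).

  This shows at once that extreme points of the feasible sets have small rank.  For an optimal
  solution of small rank, start from any optimal \<open>X\<close> and its \<open>x\<close>.  The optimal solutions
  majorized by this \<open>x\<close> form a nonempty compact convex set, which has an extreme point by the
  Krein-Milman theorem.  Optimality makes the objective constant along every feasible segment
  around this point, so the objective does not count as a further constraint and the bound is
  the same (\<open>card_nonzero_le_if_rigid\<close>).
\<close>

section \<open>Largest sums and majorization\<close>

text \<open>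
  The sum of the \<open>l\<close> largest entries is the maximum of the sums over sets of \<open>l\<close> coordinates:
  the first \<open>l\<close> coordinates in decreasing order dominate entrywise those outside, so
  exchanging members of another set for them cannot lower its sum.
\<close>

lemma sum_largest_max_subset_sum:
  fixes y :: "real ^ 'n::{finite,linorder}"
  assumes l: "l \<le> CARD('n)"
  shows "\<exists>T. card T = l \<and> sum_largest l y = (\<Sum>i\<in>T. y $ i)"
    and "card S = l \<Longrightarrow> (\<Sum>i\<in>S. y $ i) \<le> sum_largest l y"
proof -
  define ws where "ws = rev (sort_key (\<lambda>i. y $ i) (sorted_list_of_set (UNIV :: 'n set)))"
  have ws: "distinct ws" "set ws = UNIV" "length ws = CARD('n)"
    unfolding ws_def by auto
  have "map (\<lambda>i. y $ i) (rev ws) = sort (entries y)"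
    unfolding entries_def by (rule properties_for_sort[symmetric]) (auto simp: ws_def)
  hence map_ws: "rev (sort (entries y)) = map (\<lambda>i. y $ i) ws"
    by (metis rev_map rev_rev_ident)
  have sorted_ws: "sorted (map (\<lambda>i. y $ i) (rev ws))"
    by (simp add: ws_def)
  define T where "T = set (take l ws)"
  have card_T: "card T = l"
    using ws l by (simp add: T_def distinct_card)
  have sum_T: "sum_largest l y = (\<Sum>i\<in>T. y $ i)"
    using ws(1) by (simp add: sum_largest_def map_ws take_map T_def sum_list_distinct_conv_sum_set)
  show "\<exists>T. card T = l \<and> sum_largest l y = (\<Sum>i\<in>T. y $ i)"
    using card_T sum_T by blast
  have le: "y $ j \<le> y $ i" if "i \<in> T" "j \<notin> T" for i j
  proof -
    have "j \<in> set (drop l ws)"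
      using that ws(2) by (metis T_def UNIV_I Un_iff append_take_drop_id set_append)
    moreover have "sorted_wrt (\<lambda>a b. y $ b \<le> y $ a) (take l ws @ drop l ws)"
      using sorted_ws by (simp add: sorted_map sorted_wrt_rev)
    ultimately show ?thesis
      using that(1) unfolding sorted_wrt_append T_def by blast
  qed
  show "(\<Sum>i\<in>S. y $ i) \<le> sum_largest l y" if S: "card S = l"
  proof -
    have card_eq: "card (S - T) = card (T - S)"
      using S card_T by (simp add: card_Diff_subset_Int Int_commute)
    have "(\<Sum>i\<in>S - T. y $ i) \<le> (\<Sum>i\<in>T - S. y $ i)"
    proof -
      obtain b where b: "bij_betw b (S - T) (T - S)"
        using card_eq finite_same_card_bij[of "S - T" "T - S"] by auto
      have "(\<Sum>i\<in>S - T. y $ i) \<le> (\<Sum>i\<in>S - T. y $ b i)"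
        using b le by (intro sum_mono) (auto dest: bij_betwE)
      also have "\<dots> = (\<Sum>i\<in>T - S. y $ i)"
        by (rule sum.reindex_bij_betw[OF b])
      finally show ?thesis .
    qed
    moreover have "(\<Sum>i\<in>S. y $ i) = (\<Sum>i\<in>S - T. y $ i) + (\<Sum>i\<in>S \<inter> T. y $ i)"
      by (metis finite sum.Int_Diff add.commute)
    moreover have "(\<Sum>i\<in>T. y $ i) = (\<Sum>i\<in>T - S. y $ i) + (\<Sum>i\<in>S \<inter> T. y $ i)"
      by (metis finite sum.Int_Diff add.commute Int_commute)
    ultimately show ?thesis
      using sum_T by simp
  qed
qed

text \<open>
  Written this way, the vectors majorized by \<open>x\<close> are visibly a polytope, cut out by one linear
  inequality for each set of coordinates; no sorting of \<open>y\<close> is involved any more.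
\<close>

lemma majorizes_iff_subset_sums:
  fixes x y :: "real ^ 'n::{finite,linorder}"
  shows "majorizes x y \<longleftrightarrow>
    (\<forall>S. (\<Sum>i\<in>S. y $ i) \<le> sum_largest (card S) x) \<and> (\<Sum>i\<in>UNIV. y $ i) = (\<Sum>i\<in>UNIV. x $ i)"
proof -
  have "(\<forall>l\<in>{1..CARD('n)}. sum_largest l y \<le> sum_largest l x) \<longleftrightarrow>
      (\<forall>S. (\<Sum>i\<in>S. y $ i) \<le> sum_largest (card S) x)" (is "?L \<longleftrightarrow> ?R")
  proof
    assume L: ?L
    show ?R
    proof
      fix S :: "'n set"
      have c: "card S \<le> CARD('n)" by (simp add: card_mono)
      show "(\<Sum>i\<in>S. y $ i) \<le> sum_largest (card S) x"
      proof (cases "S = {}")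
        case True
        thus ?thesis by (simp add: sum_largest_def)
      next
        case False
        hence "card S \<in> {1..CARD('n)}"
          using c by (simp add: Suc_le_eq card_gt_0_iff)
        thus ?thesis
          using L sum_largest_max_subset_sum(2)[OF c refl, of y] by (meson order_trans)
      qed
    qed
  next
    assume R: ?R
    show ?L
      using sum_largest_max_subset_sum(1)[of _ y] R by (metis atLeastAtMost_iff)
  qed
  thus ?thesis
    unfolding majorizes_def by auto
qed

lemma compact_majorized:
  fixes x :: "real ^ 'n::{finite,linorder}"
  shows "compact {y. majorizes x y}"
proof -
  let ?g = "\<lambda>l. sum_largest l x" and ?c = "\<Sum>i\<in>UNIV. x $ i"
  have "closed {y. majorizes x y}"
    unfolding majorizes_iff_subset_sums
    by (intro closed_Collect_conj closed_Collect_all closed_Collect_le closed_Collect_eq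
        continuous_intros)
  moreover have "bounded {y. majorizes x y}"
  proof (rule boundedI)
    fix y assume "y \<in> {y. majorizes x y}"
    hence y: "(\<Sum>i\<in>S. y $ i) \<le> ?g (card S)" "(\<Sum>i\<in>UNIV. y $ i) = ?c" for S
      by (simp_all add: majorizes_iff_subset_sums)
    \<comment> \<open>An entry is bounded above by the inequality for its own singleton, and below by the
      inequality for the complement, since the total is prescribed.\<close>
    have "\<bar>y $ i\<bar> \<le> \<bar>?g 1\<bar> + \<bar>?c\<bar> + \<bar>?g (CARD('n) - 1)\<bar>" for i
    proof -
      have "y $ i \<le> ?g 1"
        using y(1)[of "{i}"] by simp
      moreover have "?c - y $ i \<le> ?g (CARD('n) - 1)"
        using y(1)[of "UNIV - {i}"] y(2) by (simp add: sum_diff1)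
      ultimately show ?thesis by linarith
    qed
    hence "(\<Sum>i\<in>UNIV. \<bar>y $ i\<bar>) \<le> (\<Sum>i\<in>(UNIV::'n set). \<bar>?g 1\<bar> + \<bar>?c\<bar> + \<bar>?g (CARD('n) - 1)\<bar>)"
      by (intro sum_mono)
    thus "norm y \<le> (\<Sum>i\<in>(UNIV::'n set). \<bar>?g 1\<bar> + \<bar>?c\<bar> + \<bar>?g (CARD('n) - 1)\<bar>)"
      using norm_le_l1_cart[of y] by linarith
  qed
  ultimately show ?thesis
    by (simp add: compact_eq_bounded_closed)
qed

lemma convex_majorized:
  fixes x :: "real ^ 'n::{finite,linorder}"
  shows "convex {y. majorizes x y}"
proof -
  have lin: "linear (\<lambda>y. \<Sum>i\<in>S. y $ i)" for S :: "'n set"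
    by (rule linearI) (simp_all add: sum.distrib scaleR_sum_right)
  have "convex {y. (\<Sum>i\<in>S. y $ i) \<le> c}" for S :: "'n set" and c :: real
    using convex_linear_vimage[OF lin, of "{..c}" S] by (simp add: vimage_def)
  moreover have "convex {y. (\<Sum>i\<in>S. y $ i) = c}" for S :: "'n set" and c :: real
    using convex_linear_vimage[OF lin, of "{c}" S] by (simp add: vimage_def)
  moreover have "{y. majorizes x y} =
      (\<Inter>S. {y. (\<Sum>i\<in>S. y $ i) \<le> sum_largest (card S) x}) \<inter>
      {y. (\<Sum>i\<in>UNIV. y $ i) = (\<Sum>i\<in>UNIV. x $ i)}"
    by (auto simp: majorizes_iff_subset_sums)
  ultimately show ?thesis
    by (auto intro!: convex_Int convex_INT)
qed

lemma rev_sort_antimono: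
  fixes xs :: "real list"
  assumes "i \<le> j" "j < length xs"
  shows "rev (sort xs) ! j \<le> rev (sort xs) ! i"
  using assms by (simp add: rev_nth sorted_nth_mono)

lemma sum_largest_eq_prefix_sum:
  fixes x :: "real ^ 'n::{finite,linorder}"
  assumes "l \<le> CARD('n)"
  shows "sum_largest l x = (\<Sum>i<l. rev (sort (entries x)) ! i)"
  using assms
  by (simp add: sum_largest_def sum_list_sum_nth entries_def atLeast0LessThan)

text \<open>
  Concavity of \<open>l \<mapsto> sum_largest l x\<close>, in the form that makes a function of the cardinality
  submodular: the increments are the entries of \<open>x\<close> in decreasing order.
\<close>

lemma sum_largest_concave:
  fixes x :: "real ^ 'n::{finite,linorder}"
  assumes "a \<le> b" "a \<le> c" "a + d = b + c" "d \<le> CARD('n)"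
  shows "sum_largest a x + sum_largest d x \<le> sum_largest b x + sum_largest c x"
proof -
  let ?u = "\<lambda>i. rev (sort (entries x)) ! i"
  have split: "(\<Sum>i<p + k. ?u i) = (\<Sum>i<p. ?u i) + (\<Sum>i<k. ?u (p + i))" for p k
    by (induction k) auto
  have eqs: "b = a + (b - a)" "d = c + (b - a)"
    using assms by auto
  have "(\<Sum>i<b - a. ?u (c + i)) \<le> (\<Sum>i<b - a. ?u (a + i))"
    using assms by (intro sum_mono rev_sort_antimono) (auto simp: entries_def)
  moreover have "(\<Sum>i<b. ?u i) = (\<Sum>i<a. ?u i) + (\<Sum>i<b - a. ?u (a + i))"
    using split[of a "b - a"] eqs(1) by simp
  moreover have "(\<Sum>i<d. ?u i) = (\<Sum>i<c. ?u i) + (\<Sum>i<b - a. ?u (c + i))"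
    using split[of c "b - a"] eqs(2) by simp
  ultimately show ?thesis
    using assms by (simp add: sum_largest_eq_prefix_sum)
qed

lemma nth_rev_sort_entries:
  fixes x :: "real ^ 'n::{finite,linorder}"
  assumes dec: "\<forall>j\<in>{1..<CARD('n)}. entry x (j + 1) \<le> entry x j"
  shows "rev (sort (entries x)) ! i = entry x (Suc i)"
proof -
  have "sorted_wrt (\<lambda>a b. b \<le> a) (entries x)"
  proof -
    have "entries x ! Suc i \<le> entries x ! i" if "Suc i < length (entries x)" for i
      using dec[rule_format, of "Suc i"] that by (simp add: entry_def entries_def)
    thus ?thesis
      by (subst sorted_wrt_iff_nth_Suc_transp) (auto intro: transpI)
  qed
  hence "sorted (rev (entries x))"
    by (simp add: sorted_wrt_rev)
  hence "sort (entries x) = rev (entries x)"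
    by (intro properties_for_sort) simp_all
  thus ?thesis
    by (simp add: entry_def)
qed

text \<open>
  The entries before the zero window are nonnegative and those after it nonpositive, so the
  prefix sums climb to a plateau, stay there along the window, and descend.
\<close>

lemma sum_largest_plateau:
  fixes x :: "real ^ 'n::{finite,linorder}"
  assumes dec: "\<forall>j\<in>{1..<CARD('n)}. entry x (j + 1) \<le> entry x j"
    and r: "r < CARD('n)" and s: "1 \<le> s" "s \<le> r + 1"
    and zero: "entry x s = 0" "entry x (s + CARD('n) - r - 1) = 0"
  shows "l \<le> CARD('n) \<Longrightarrow> sum_largest l x \<le> sum_largest (s - 1) x"
    and "s - 1 \<le> l \<Longrightarrow> l \<le> s + CARD('n) - r - 1 \<Longrightarrow> sum_largest l x = sum_largest (s - 1) x"
proof -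
  let ?u = "\<lambda>i. rev (sort (entries x)) ! i" and ?n = "CARD('n)"
  have mono: "?u j \<le> ?u i" if "i \<le> j" "j < ?n" for i j
    using that by (intro rev_sort_antimono) (auto simp: entries_def)
  have u: "?u (s - 1) = 0" "?u (s + ?n - r - 2) = 0"
    using nth_rev_sort_entries[OF dec] zero s r by (auto simp: Suc_diff_Suc numeral_2_eq_2)
  have split: "(\<Sum>i<l. ?u i) = (\<Sum>i<s - 1. ?u i) + (\<Sum>i=s - 1..<l. ?u i)" if "s - 1 \<le> l" for l
    using that by (metis atLeast0LessThan sum.atLeastLessThan_concat zero_le)
  show "sum_largest l x \<le> sum_largest (s - 1) x" if l: "l \<le> ?n"
  proof (cases "s - 1 \<le> l")
    case True
    have "(\<Sum>i=s - 1..<l. ?u i) \<le> 0"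
      using mono[of "s - 1"] u(1) l by (intro sum_nonpos) auto
    thus ?thesis
      using split[OF True] l s r by (simp add: sum_largest_eq_prefix_sum)
  next
    case False
    have "(\<Sum>i<l. ?u i) \<le> (\<Sum>i<s - 1. ?u i)"
      using mono[of _ "s - 1"] u(1) False s r by (intro sum_mono2) auto
    thus ?thesis
      using l s r by (simp add: sum_largest_eq_prefix_sum)
  qed
  show "sum_largest l x = sum_largest (s - 1) x" if l: "s - 1 \<le> l" "l \<le> s + ?n - r - 1"
  proof -
    have "?u i = 0" if "i \<in> {s - 1..<l}" for i
      using mono[of "s - 1" i] mono[of i "s + ?n - r - 2"] u that l s r
      by (intro antisym) auto
    hence "(\<Sum>i=s - 1..<l. ?u i) = 0"
      by (intro sum.neutral) blast
    thus ?thesis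
      using split[OF l(1)] l s r by (simp add: sum_largest_eq_prefix_sum)
  qed
qed

section \<open>Indicator vectors of a lattice of sets\<close>

definition ind :: "'n set \<Rightarrow> real ^ 'n"
  where "ind S = (\<chi> i. if i \<in> S then 1 else 0)"

lemma ind_inner: "ind S \<bullet> d = (\<Sum>i\<in>S. d $ i)" for S :: "'n::finite set"
proof -
  have "(\<Sum>i\<in>S. d $ i) = (\<Sum>i\<in>UNIV. if i \<in> S then d $ i else 0)"
    by (intro sum.mono_neutral_cong_left) auto
  also have "\<dots> = ind S \<bullet> d"
    unfolding ind_def inner_vec_def by (intro sum.cong) auto
  finally show ?thesis ..
qed

lemma ind_Un_Int: "ind (S \<union> T) + ind (S \<inter> T) = ind S + ind T" for S T :: "'n::finite set"
  by (auto simp: ind_def vec_eq_iff)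

lemma ex_max_card:
  fixes L :: "'n::finite set set"
  assumes "L \<noteq> {}"
  shows "\<exists>U\<in>L. \<forall>S\<in>L. card S \<le> card U"
proof -
  have "Max (card ` L) \<in> card ` L"
    using assms by (intro Max_in) simp_all
  then obtain U where "U \<in> L" "Max (card ` L) = card U"
    by (rule imageE)
  moreover have "card S \<le> Max (card ` L)" if "S \<in> L" for S
    using that by (intro Max_ge) simp_all
  ultimately show ?thesis
    by auto
qed

text \<open>
  The indicator vectors of a lattice of sets are spanned by those of a maximal chain, which
  meets every cardinality at most once.  The chain is built from the top: if \<open>U\<close> is the
  largest member and \<open>V\<close> is maximal among the others, then each member is contained in \<open>V\<close> or
  has union \<open>U\<close> with it, and in the second case \<open>ind S = ind U + ind (S \<inter> V) - ind V\<close>.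
\<close>

lemma lattice_ind_span:
  fixes L :: "'n::finite set set"
  assumes "\<And>S T. S \<in> L \<Longrightarrow> T \<in> L \<Longrightarrow> S \<union> T \<in> L \<and> S \<inter> T \<in> L"
  shows "\<exists>C. (\<forall>l\<in>card ` L. C l \<in> L \<and> card (C l) = l) \<and>
             (\<forall>S\<in>L. ind S \<in> span ((\<lambda>l. ind (C l)) ` card ` L))"
  using assms
proof (induction "card L" arbitrary: L rule: less_induct)
  case less
  note lattice = less.prems
  show ?case
  proof (cases "L = {}")
    case True
    thus ?thesis by simp
  next
    case False
    have "\<exists>U\<in>L. \<forall>S\<in>L. card S \<le> card U"
      using False by (rule ex_max_card)
    then obtain U where U: "U \<in> L" "\<And>S. S \<in> L \<Longrightarrow> card S \<le> card U"
      by blast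
    have below_U: "S \<subseteq> U" if "S \<in> L" for S
      using U(2)[of "S \<union> U"] lattice[OF that U(1)]
      by (metis Un_upper1 Un_upper2 card_seteq finite)
    show ?thesis
    proof (cases "L = {U}")
      case True
      thus ?thesis
        by (intro exI[of _ "\<lambda>_. U"]) (auto intro: span_base)
    next
      case not_single: False
      hence "L - {U} \<noteq> {}"
        using U(1) by blast
      hence "\<exists>V\<in>L - {U}. \<forall>S\<in>L - {U}. card S \<le> card V"
        by (rule ex_max_card)
      then obtain V where V: "V \<in> L" "V \<noteq> U" "\<And>S. S \<in> L \<Longrightarrow> S \<noteq> U \<Longrightarrow> card S \<le> card V"
        by blast
      have below_V: "S \<union> V = U" if "S \<in> L" "\<not> S \<subseteq> V" for S
        using V(3)[of "S \<union> V"] lattice[OF that(1) V(1)] that(2)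
        by (metis Un_upper1 Un_upper2 card_seteq finite)
      define K where "K = {S \<in> L. S \<subseteq> V}"
      have "V \<subset> U"
        using V below_U by blast
      hence U_notin: "U \<notin> K" and card_less: "S \<in> K \<Longrightarrow> card S < card U" for S
        unfolding K_def by (auto intro!: psubset_card_mono)
      have "card K < card L"
        using U(1) U_notin by (intro psubset_card_mono) (auto simp: K_def)
      moreover have "S \<union> T \<in> K \<and> S \<inter> T \<in> K" if "S \<in> K" "T \<in> K" for S T
        using that lattice by (auto simp: K_def)
      ultimately obtain C where C: "\<forall>l\<in>card ` K. C l \<in> K \<and> card (C l) = l"
        "\<forall>S\<in>K. ind S \<in> span ((\<lambda>l. ind (C l)) ` card ` K)"
        using less.hyps[of K] by blast
      define D where "D = (\<lambda>l. if l \<in> card ` K then C l else SOME S. S \<in> L \<and> card S = l)"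
      have D_ex: "D l \<in> L \<and> card (D l) = l" if "l \<in> card ` L" for l
      proof (cases "l \<in> card ` K")
        case True
        thus ?thesis using C(1) by (auto simp: D_def K_def)
      next
        case not_K: False
        have "\<exists>S. S \<in> L \<and> card S = l"
          using that by blast
        from someI_ex[OF this] show ?thesis
          using not_K by (simp add: D_def)
      qed
      let ?W = "span ((\<lambda>l. ind (D l)) ` card ` L)"
      have "(\<lambda>l. ind (C l)) ` card ` K \<subseteq> (\<lambda>l. ind (D l)) ` card ` L"
        unfolding image_image by (auto simp: D_def K_def intro!: rev_image_eqI)
      hence K_span: "ind S \<in> ?W" if "S \<in> K" for S
        using C(2) that span_mono by blast
      have "D (card U) = U"
        using D_ex[of "card U"] below_U U(1) by (metis card_subset_eq finite imageI)
      hence U_span: "ind U \<in> ?W"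
        using U(1) by (metis imageI span_base)
      have "ind S \<in> ?W" if S: "S \<in> L" for S
      proof (cases "S \<subseteq> V")
        case True
        thus ?thesis using K_span S by (simp add: K_def)
      next
        case False
        have "ind S = ind U + ind (S \<inter> V) - ind V"
          using ind_Un_Int[of S V] below_V[OF S False] by (simp add: algebra_simps)
        moreover have "S \<inter> V \<in> K" "V \<in> K"
          using lattice[OF S V(1)] V(1) by (auto simp: K_def)
        ultimately show ?thesis
          using K_span U_span by (metis span_add span_diff)
      qed
      thus ?thesis
        using D_ex by blast
    qed
  qed
qed

section \<open>Tight subset sums\<close>

text \<open>
  The tight sets form a lattice because \<open>g \<circ> card\<close> is submodular, so one tight set for each
  cardinality suffices.  A tight set whose cardinality lies on the plateau has the largest subset
  sum that \<open>y\<close> can have; hence it contains all positive and no negative coordinates, and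
  up to zero coordinates its indicator is that of the positive coordinates.  Together with this one
  vector (which vanishes if the plateau starts at \<open>0\<close>) the cardinalities off the
  plateau contribute \<open>r\<close> generators.
\<close>

lemma dim_tight_sets_le:
  fixes y :: "real ^ 'n::finite"
  assumes dom: "\<And>S. (\<Sum>i\<in>S. y $ i) \<le> g (card S)"
    and g0: "g 0 = 0"
    and concave: "\<And>a b c d. a \<le> b \<Longrightarrow> a \<le> c \<Longrightarrow> a + d = b + c \<Longrightarrow> d \<le> CARD('n) \<Longrightarrow>
      g a + g d \<le> g b + g c"
    and top: "\<And>l. l \<le> CARD('n) \<Longrightarrow> g l \<le> g p"
    and plateau: "\<And>l. p \<le> l \<Longrightarrow> l \<le> p + (CARD('n) - r) \<Longrightarrow> g l = g p"
    and r: "r \<le> CARD('n)" "p \<le> r"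
  shows "dim (ind ` {S. (\<Sum>i\<in>S. y $ i) = g (card S)}) \<le> r + card {i. y $ i = 0}"
proof -
  define L where "L = {S. (\<Sum>i\<in>S. y $ i) = g (card S)}"
  have card_le: "card S \<le> CARD('n)" for S :: "'n set"
    by (simp add: card_mono)
  have "S \<union> T \<in> L \<and> S \<inter> T \<in> L" if "S \<in> L" "T \<in> L" for S T
  proof -
    have "(\<Sum>i\<in>S \<union> T. y $ i) + (\<Sum>i\<in>S \<inter> T. y $ i) = (\<Sum>i\<in>S. y $ i) + (\<Sum>i\<in>T. y $ i)"
      by (rule sum.union_inter) auto
    moreover have "g (card (S \<inter> T)) + g (card (S \<union> T)) \<le> g (card S) + g (card T)"
      by (intro concave card_le) (auto intro: card_mono simp: card_Un_Int[of S T])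
    ultimately show ?thesis
      using that dom[of "S \<union> T"] dom[of "S \<inter> T"] by (simp add: L_def)
  qed
  then obtain C where C: "\<forall>l\<in>card ` L. C l \<in> L \<and> card (C l) = l"
    "\<forall>S\<in>L. ind S \<in> span ((\<lambda>l. ind (C l)) ` card ` L)"
    using lattice_ind_span[of L] by blast
  define Pos where "Pos = {i. y $ i > 0}"
  define Z where "Z = {i. y $ i = 0}"
  define N where "N = {1..p} \<union> {p + (CARD('n) - r) + 1..CARD('n)}"
  \<comment> \<open>The slot \<open>p\<close> holds the vector for the whole plateau.\<close>
  define v where "v = (\<lambda>l. if l = p then ind Pos else ind (C l))"
  define G where "G = v ` N \<union> (\<lambda>i. axis i 1) ` Z"
  have "card N = r"
    using r unfolding N_def by (subst card_Un_disjoint) auto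
  moreover have "finite N"
    by (simp add: N_def)
  ultimately have card_G: "finite G" "card G \<le> r + card Z"
    unfolding G_def using card_image_le[of N v] card_image_le[of Z "\<lambda>i. axis i (1::real)"]
      card_Un_le[of "v ` N" "(\<lambda>i. axis i 1) ` Z"] by auto
  have Pos_sum: "(\<Sum>i\<in>Pos. y $ i) \<le> g p"
    using dom[of Pos] top[OF card_le[of Pos]] by linarith
  have Pos_span: "ind Pos \<in> span G"
  proof (cases "p = 0")
    case True
    have "Pos = {}"
    proof (rule ccontr)
      assume "Pos \<noteq> {}"
      hence "(\<Sum>i\<in>Pos. y $ i) > 0"
        by (intro sum_pos) (auto simp: Pos_def)
      thus False using Pos_sum True g0 by simp
    qed
    hence "ind Pos = 0"
      by (simp add: ind_def vec_eq_iff)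
    thus ?thesis by (simp add: span_zero)
  next
    case False
    hence "v p \<in> G"
      by (auto simp: G_def N_def)
    thus ?thesis
      by (simp add: v_def span_base)
  qed
  have plateau_span: "ind S \<in> span G"
    if S: "S \<in> L" "p \<le> card S" "card S \<le> p + (CARD('n) - r)" for S
  proof -
    have "(\<Sum>i\<in>S. y $ i) = g p"
      using S(1) plateau[OF S(2,3)] by (simp add: L_def)
    hence "(\<Sum>i\<in>Pos. y $ i) \<le> (\<Sum>i\<in>S. y $ i)"
      using Pos_sum by simp
    moreover have "(\<Sum>i\<in>Pos. y $ i) = (\<Sum>i\<in>S. y $ i) + (\<Sum>i\<in>Pos - S. y $ i) - (\<Sum>i\<in>S - Pos. y $ i)"
      using sum.Int_Diff[of Pos "\<lambda>i. y $ i" S] sum.Int_Diff[of S "\<lambda>i. y $ i" Pos]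
      unfolding Int_commute[of S Pos] by auto
    moreover have "(\<Sum>i\<in>S - Pos. y $ i) \<le> 0" "(\<Sum>i\<in>Pos - S. y $ i) \<ge> 0"
      by (auto intro!: sum_nonpos sum_nonneg simp: Pos_def)
    ultimately have sums: "(\<Sum>i\<in>S - Pos. - (y $ i)) = 0" "(\<Sum>i\<in>Pos - S. y $ i) = 0"
      unfolding sum_negf by linarith+
    have neg: "- (y $ i) = 0" if "i \<in> S - Pos" for i
      by (rule sum_nonneg_0[OF _ _ sums(1) that]) (auto simp: Pos_def)
    have pos: "y $ i = 0" if "i \<in> Pos - S" for i
      by (rule sum_nonneg_0[OF _ _ sums(2) that]) (auto simp: Pos_def)
    have "Pos \<subseteq> S"
      using pos by (metis DiffI Pos_def less_irrefl mem_Collect_eq subsetI)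
    have "S - Pos \<subseteq> Z"
      using neg by (auto simp: Z_def)
    have "ind S = ind Pos + (\<Sum>j\<in>S - Pos. axis j 1)"
    proof -
      have "(\<Sum>j\<in>S - Pos. (axis j 1 :: (real, 'n) vec) $ i) = (if i \<in> S - Pos then 1 else 0)" for i
        by (simp add: axis_def)
      thus ?thesis
        using \<open>Pos \<subseteq> S\<close> by (auto simp: ind_def vec_eq_iff)
    qed
    moreover have "axis j 1 \<in> span G" if "j \<in> S - Pos" for j
      using that \<open>S - Pos \<subseteq> Z\<close> by (intro span_base) (auto simp: G_def)
    ultimately show ?thesis
      using Pos_span by (auto intro!: span_add span_sum)
  qed
  have "ind (C l) \<in> span G" if l: "l \<in> card ` L" for l
  proof -
    have Cl: "C l \<in> L" "card (C l) = l"
      using C(1) l by auto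
    have "l \<le> CARD('n)"
      using l card_le by blast
    hence "(p \<le> l \<and> l \<le> p + (CARD('n) - r)) \<or> (l \<in> N \<and> l \<noteq> p) \<or> l = 0"
      unfolding N_def Un_iff atLeastAtMost_iff by linarith
    then consider "p \<le> l" "l \<le> p + (CARD('n) - r)" | "l \<in> N" "l \<noteq> p" | "l = 0"
      by blast
    thus ?thesis
    proof cases
      case 1
      thus ?thesis using plateau_span Cl by simp
    next
      case 2
      hence "v l \<in> G" "v l = ind (C l)"
        by (auto simp: G_def v_def)
      thus ?thesis by (metis span_base)
    next
      case 3
      hence "ind (C l) = 0"
        using Cl(2) by (simp add: ind_def vec_eq_iff)
      thus ?thesis by (simp add: span_zero)
    qed
  qed
  hence "span ((\<lambda>l. ind (C l)) ` card ` L) \<subseteq> span G"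
    by (intro span_minimal) auto
  hence "ind ` L \<subseteq> span G"
    using C(2) by blast
  hence "dim (ind ` L) \<le> card G"
    using card_G(1) by (rule dim_le_card)
  thus ?thesis
    using card_G(2) by (simp add: L_def Z_def)
qed

text \<open>
  A direction that is orthogonal to the indicators of the tight sets can be followed a little
  both ways without leaving the polytope of vectors majorized by \<open>x\<close>.  By the dimension bound,
  such directions orthogonal to \<open>B\<close> as well exist as soon as \<open>y\<close> has too many nonzero entries.
\<close>

lemma majorized_perturbation:
  fixes x y :: "real ^ 'n::{finite,linorder}"
  assumes dec: "\<forall>j\<in>{1..<CARD('n)}. entry x (j + 1) \<le> entry x j"
    and r: "r < CARD('n)" and s: "1 \<le> s" "s \<le> r + 1"
    and zero: "entry x s = 0" "entry x (s + CARD('n) - r - 1) = 0"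
    and maj: "majorizes x y"
    and many: "r + dim B < card {i. y $ i \<noteq> 0}"
  obtains d where "d \<noteq> 0" "\<And>b. b \<in> B \<Longrightarrow> b \<bullet> d = 0" "majorizes x (y + d)" "majorizes x (y - d)"
proof -
  let ?g = "\<lambda>l. sum_largest l x"
  define L where "L = {S. (\<Sum>i\<in>S. y $ i) = ?g (card S)}"
  have dom: "(\<Sum>i\<in>S. y $ i) \<le> ?g (card S)" and tot: "(\<Sum>i\<in>UNIV. y $ i) = (\<Sum>i\<in>UNIV. x $ i)" for S
    using maj by (simp_all add: majorizes_iff_subset_sums)
  have "dim (ind ` L) \<le> r + card {i. y $ i = 0}"
    unfolding L_def
  proof (rule dim_tight_sets_le[where p = "s - 1"])
    show "?g l = ?g (s - 1)" if "s - 1 \<le> l" "l \<le> s - 1 + (CARD('n) - r)" for l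
      using that r s by (intro sum_largest_plateau(2)[OF dec r s zero]) auto
    show "?g l \<le> ?g (s - 1)" if "l \<le> CARD('n)" for l
      using sum_largest_plateau(1)[OF dec r s zero that] .
    show "?g a + ?g d \<le> ?g b + ?g c" if "a \<le> b" "a \<le> c" "a + d = b + c" "d \<le> CARD('n)" for a b c d
      using that by (rule sum_largest_concave)
  qed (use dom r s in \<open>simp_all add: sum_largest_def[of 0]\<close>)
  moreover have "card {i. y $ i = 0} + card {i. y $ i \<noteq> 0} = CARD('n)"
  proof -
    have "card ({i. y $ i = 0} \<union> {i. y $ i \<noteq> 0}) = card {i. y $ i = 0} + card {i. y $ i \<noteq> 0}"
      by (rule card_Un_disjoint) auto
    moreover have "{i. y $ i = 0} \<union> {i. y $ i \<noteq> 0} = UNIV" by auto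
    ultimately show ?thesis by simp
  qed
  moreover have "dim (ind ` L \<union> B) \<le> dim (ind ` L) + dim B"
  proof -
    obtain P where P: "finite P" "ind ` L \<subseteq> span P" "card P = dim (ind ` L)"
      by (metis basis_exists finiteI_independent)
    obtain Q where Q: "finite Q" "B \<subseteq> span Q" "card Q = dim B"
      by (metis basis_exists finiteI_independent)
    have "ind ` L \<union> B \<subseteq> span (P \<union> Q)"
      using P(2) Q(2) by (meson Un_least Un_upper1 Un_upper2 order_trans span_mono)
    hence "dim (ind ` L \<union> B) \<le> card (P \<union> Q)"
      using P(1) Q(1) by (intro dim_le_card) auto
    thus ?thesis
      using card_Un_le[of P Q] P(3) Q(3) by simp
  qed
  ultimately have "dim (ind ` L \<union> B) < DIM((real, 'n) vec)"
    using many by simp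
  then obtain d where d: "d \<noteq> 0" "\<And>v. v \<in> span (ind ` L \<union> B) \<Longrightarrow> orthogonal d v"
    by (rule orthogonal_to_subspace_exists) blast
  have d_orth: "v \<bullet> d = 0" if "v \<in> ind ` L \<union> B" for v
    using d(2)[OF span_base[OF that]] by (simp add: orthogonal_def inner_commute)
  have d_tight: "(\<Sum>i\<in>S. d $ i) = 0" if "(\<Sum>i\<in>S. y $ i) = ?g (card S)" for S
    using d_orth[of "ind S"] that by (simp add: L_def ind_inner)
  have "\<exists>e>0. \<forall>t. \<bar>t\<bar> \<le> e \<longrightarrow> (\<Sum>i\<in>S. y $ i) + t * (\<Sum>i\<in>S. d $ i) \<le> ?g (card S)" for S
  proof (cases "(\<Sum>i\<in>S. y $ i) = ?g (card S)")
    case True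
    thus ?thesis using d_tight[OF True] by (intro exI[of _ 1]) simp
  next
    case False
    define a b where "a = ?g (card S) - (\<Sum>i\<in>S. y $ i)" and "b = (\<Sum>i\<in>S. d $ i)"
    have a: "a > 0"
      using False dom[of S] by (simp add: a_def)
    have "t * b \<le> a" if "\<bar>t\<bar> \<le> a / (\<bar>b\<bar> + 1)" for t
    proof -
      have "t * b \<le> \<bar>t\<bar> * \<bar>b\<bar>"
        by (metis abs_ge_self abs_mult)
      also have "\<dots> \<le> \<bar>t\<bar> * (\<bar>b\<bar> + 1)"
        by (simp add: mult_left_mono)
      also have "\<dots> \<le> a"
        using that by (subst pos_le_divide_eq[symmetric]) auto
      finally show ?thesis .
    qed
    hence "\<forall>t. \<bar>t\<bar> \<le> a / (\<bar>b\<bar> + 1) \<longrightarrow> (\<Sum>i\<in>S. y $ i) + t * b \<le> ?g (card S)"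
      by (simp add: a_def algebra_simps)
    moreover have "a / (\<bar>b\<bar> + 1) > 0"
      using a by (intro divide_pos_pos) auto
    ultimately show ?thesis
      unfolding b_def by blast
  qed
  then obtain e where e: "\<And>S. e S > 0"
    "\<And>S t. \<bar>t\<bar> \<le> e S \<Longrightarrow> (\<Sum>i\<in>S. y $ i) + t * (\<Sum>i\<in>S. d $ i) \<le> ?g (card S)"
    by metis
  define h where "h = Min (range e)"
  have h: "h > 0" "\<And>S. h \<le> e S"
    using e(1) by (auto simp: h_def)
  \<comment> \<open>The full set is tight, so the direction respects the prescribed total as well.\<close>
  have UNIV_tight: "(\<Sum>i\<in>UNIV. d $ i) = 0"
  proof -
    obtain T where "card T = CARD('n)" "?g (CARD('n)) = (\<Sum>i\<in>T. x $ i)"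
      using sum_largest_max_subset_sum(1)[of "CARD('n)" x] by blast
    thus ?thesis
      using d_tight[of UNIV] tot by (metis card_eq_UNIV_imp_eq_UNIV finite)
  qed
  have maj_t: "majorizes x (y + t *\<^sub>R d)" if "\<bar>t\<bar> \<le> h" for t
    using e(2)[OF order_trans[OF that h(2)]] tot UNIV_tight
    by (simp add: majorizes_iff_subset_sums sum.distrib flip: sum_distrib_left)
  show ?thesis
  proof (rule that[of "h *\<^sub>R d"])
    show "majorizes x (y - h *\<^sub>R d)"
      using maj_t[of "- h"] h(1) by simp
  qed (use maj_t[of h] h(1) d(1) d_orth in auto)
qed

section \<open>Diagonal matrices and the feasible sets\<close>

lemma linear_Diag: "linear (Diag :: real ^ 'n::finite \<Rightarrow> _)"
  by (rule linearI) (auto simp: Diag_def vec_eq_iff)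

lemma linear_diag_vec: "linear (diag_vec :: real ^ 'n::finite ^ 'n \<Rightarrow> _)"
  by (rule linearI) (auto simp: diag_vec_def vec_eq_iff)

lemma diag_vec_Diag [simp]: "diag_vec (Diag d) = d"
  by (simp add: diag_vec_def Diag_def vec_eq_iff)

lemma Diag_symmetric: "Diag d \<in> sym_matrices"
  by (auto simp: sym_matrices_def Diag_def transpose_def vec_eq_iff)

lemma inner_Diag: "M \<bullet> Diag d = diag_vec M \<bullet> d" for M :: "real ^ 'n::finite ^ 'n"
  by (simp add: inner_vec_def Diag_def diag_vec_def if_distrib cong: if_cong)

lemma rank_Diag_le: "rank (Diag d) \<le> card {i. d $ i \<noteq> 0}" for d :: "real ^ 'n::finite"
proof -
  let ?E = "(\<lambda>i. axis i 1 :: real ^ 'n) ` {i. d $ i \<noteq> 0}"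
  have row: "row i (Diag d) = d $ i *\<^sub>R axis i 1" for i
    by (auto simp: row_def Diag_def vec_eq_iff axis_def)
  have "row i (Diag d) \<in> span ?E" for i
    by (cases "d $ i = 0") (auto simp: row span_zero intro: span_scale[OF span_base])
  hence "rows (Diag d) \<subseteq> span ?E"
    by (auto simp: rows_def)
  hence "dim (rows (Diag d)) \<le> card ?E"
    by (intro dim_le_card) auto
  also have "\<dots> \<le> card {i. d $ i \<noteq> 0}"
    by (rule card_image_le) simp
  finally show ?thesis
    by (simp only: row_rank_def)
qed

text \<open>
  The majorization is left out, so that a vector found here can be kept while \<open>y\<close> moves.
\<close>

definition window_vectors ::
    "(real ^ 'n::{finite,linorder} \<Rightarrow> real) \<Rightarrow> nat \<Rightarrow> nat \<Rightarrow> (real ^ 'n::{finite,linorder}) set"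
  where "window_vectors f r s =
    {x. f x \<le> 0 \<and>
        (\<forall>j\<in>{1..<CARD('n)}. entry x (j + 1) \<le> entry x j) \<and>
        (r < CARD('n) \<longrightarrow> entry x s = 0 \<and> entry x (s + CARD('n) - r - 1) = 0)}"

definition slab :: "nat \<Rightarrow> (nat \<Rightarrow> 'a::real_inner) \<Rightarrow> (nat \<Rightarrow> ereal) \<Rightarrow> (nat \<Rightarrow> ereal) \<Rightarrow> 'a set"
  where "slab m a bl bu = {y. \<forall>i\<in>{1..m}. bl i \<le> ereal (a i \<bullet> y) \<and> ereal (a i \<bullet> y) \<le> bu i}"

lemma Diag_mem_feasible_set:
  "Diag y \<in> feasible_set f r m A bl bu s \<longleftrightarrow>
    (\<exists>x\<in>window_vectors f r s. majorizes x y) \<and> y \<in> slab m (\<lambda>i. diag_vec (A i)) bl bu"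
  unfolding feasible_set_def Y_hat_def window_vectors_def slab_def
  by (auto simp: Diag_symmetric inner_Diag)

lemma feasible_set_diagonal:
  "X \<in> feasible_set f r m A bl bu s \<Longrightarrow> X = Diag (diag_vec X)"
  by (simp add: feasible_set_def Y_hat_def)

lemma closed_slab: "closed (slab m a bl bu)"
  unfolding slab_def Ball_def imp_conv_disj
  by (intro closed_Collect_all closed_Collect_disj closed_Collect_conj closed_Collect_const
      closed_Collect_le continuous_intros)

lemma convex_slab: "convex (slab m a bl bu)"
proof -
  have "is_interval {t. bl i \<le> ereal t \<and> ereal t \<le> bu i}" for i
    unfolding is_interval_1
  proof (intro ballI allI impI CollectI conjI)
    fix p q t
    assume p: "p \<in> {t. bl i \<le> ereal t \<and> ereal t \<le> bu i}"
      and q: "q \<in> {t. bl i \<le> ereal t \<and> ereal t \<le> bu i}" and t: "p \<le> t \<and> t \<le> q"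
    have "bl i \<le> ereal p" "ereal p \<le> ereal t" "ereal t \<le> ereal q" "ereal q \<le> bu i"
      using p q t by simp_all
    thus "bl i \<le> ereal t" "ereal t \<le> bu i"
      by (blast intro: order_trans)+
  qed
  hence "convex {t. bl i \<le> ereal t \<and> ereal t \<le> bu i}" for i
    by (simp only: is_interval_convex_1)
  hence "convex ((\<lambda>y. a i \<bullet> y) -` {t. bl i \<le> ereal t \<and> ereal t \<le> bu i})" for i
    by (intro convex_linear_vimage bounded_linear.linear bounded_linear_inner_right)
  moreover have "slab m a bl bu =
      (\<Inter>i\<in>{1..m}. (\<lambda>y. a i \<bullet> y) -` {t. bl i \<le> ereal t \<and> ereal t \<le> bu i})"
    by (auto simp: slab_def)
  ultimately show ?thesis
    by (auto intro: convex_INT)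
qed

text \<open>
  Extremality enters only through rigidity of \<open>y\<close> while \<open>x\<close> is kept fixed.  In this form the
  bound applies to extreme points of the feasible sets and also to extreme points of a set of
  optimal solutions.
\<close>

lemma card_nonzero_le_if_rigid:
  fixes x y :: "real ^ 'n::{finite,linorder}"
  assumes x: "x \<in> window_vectors f r s" and s: "s \<in> {1..r + 1}"
    and y: "majorizes x y" "y \<in> slab m a bl bu"
    and rigid: "\<And>d. majorizes x (y + d) \<Longrightarrow> majorizes x (y - d) \<Longrightarrow>
      y + d \<in> slab m a bl bu \<Longrightarrow> y - d \<in> slab m a bl bu \<Longrightarrow> d = 0"
  shows "card {i. y $ i \<noteq> 0} \<le> r + dim (a ` {1..m})"
proof (rule ccontr)
  assume many: "\<not> card {i. y $ i \<noteq> 0} \<le> r + dim (a ` {1..m})"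
  moreover have "card {i. y $ i \<noteq> 0} \<le> CARD('n)"
    by (simp add: card_mono)
  ultimately have r: "r < CARD('n)"
    by linarith
  obtain d where d: "d \<noteq> 0" "\<And>b. b \<in> a ` {1..m} \<Longrightarrow> b \<bullet> d = 0"
    "majorizes x (y + d)" "majorizes x (y - d)"
    using majorized_perturbation[of x r s y "a ` {1..m}"] x s y(1) many r
    by (auto simp: window_vectors_def)
  have "y + d \<in> slab m a bl bu" "y - d \<in> slab m a bl bu"
    using d(2) y(2) by (auto simp: slab_def inner_add_right inner_diff_right)
  thus False
    using rigid d by blast
qed

lemma extreme_point_rigid:
  fixes x :: "'a::real_normed_vector"
  assumes "x extreme_point_of S" "x + d \<in> S" "x - d \<in> S"
  shows "d = 0"
proof (rule ccontr)
  assume "d \<noteq> 0"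
  hence "d + d \<noteq> 0"
    by (simp flip: scaleR_2)
  hence "midpoint (x - d) (x + d) \<in> open_segment (x - d) (x + d)"
    by (simp add: algebra_simps)
  moreover have "midpoint (x - d) (x + d) = x"
    by (simp add: midpoint_def flip: scaleR_2)
  ultimately show False
    using assms by (auto simp: extreme_point_of_def)
qed

theorem theorem9:
  fixes f :: "real ^ 'n::{finite,linorder} \<Rightarrow> real"
    and A :: "nat \<Rightarrow> real ^ 'n::{finite,linorder} ^ 'n::{finite,linorder}"
    and bl bu :: "nat \<Rightarrow> ereal"
    and k kt m mt :: nat
  assumes "1 \<le> k" and "k \<le> CARD('n)"
    and "continuous_on UNIV f" and "convex_on UNIV f" and "symmetric_fun f"
    and "\<forall>i\<in>{0..m}. A i \<in> sym_matrices"
    and "\<forall>i\<in>{1..m}. bl i \<le> bu i"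
    and "kt = strengthened_rank f k"
    and "mt = dim (span (A ` {1..m}))"
    and "\<forall>s\<in>{1..kt+1}. contains_no_line (feasible_set f kt m A bl bu s)"
  shows "(\<forall>s\<in>{1..kt+1}. \<forall>X. X extreme_point_of (feasible_set f kt m A bl bu s)
            \<longrightarrow> rank X \<le> kt + mt) \<and>
         (finite_optimal_value f kt m A bl bu
            \<longrightarrow> (\<exists>X. optimal_solution f kt m A bl bu X \<and> rank X \<le> kt + mt))"
proof (intro conjI ballI allI impI)
  let ?a = "\<lambda>i. diag_vec (A i)"
  let ?F = "feasible_set f kt m A bl bu"
  let ?S = "slab m ?a bl bu"
  have "dim (diag_vec ` A ` {1..m}) \<le> mt"
    using dim_image_le[OF linear_diag_vec] assms(9) by simp
  hence dim_a: "dim (?a ` {1..m}) \<le> mt"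
    by (simp add: image_image)
  have rank_le: "rank (Diag y) \<le> kt + mt" if "card {i. y $ i \<noteq> 0} \<le> kt + dim (?a ` {1..m})" for y
    using rank_Diag_le[of y] that dim_a by linarith
  {
    fix s X
    assume s: "s \<in> {1..kt + 1}" and X: "X extreme_point_of ?F s"
    define y where "y = diag_vec X"
    have XF: "X \<in> ?F s"
      using X by (simp add: extreme_point_of_def)
    hence X_eq: "X = Diag y"
      using feasible_set_diagonal unfolding y_def by blast
    then obtain x where x: "x \<in> window_vectors f kt s" "majorizes x y" and y: "y \<in> ?S"
      using XF by (auto simp: Diag_mem_feasible_set)
    have "card {i. y $ i \<noteq> 0} \<le> kt + dim (?a ` {1..m})"
    proof (rule card_nonzero_le_if_rigid[OF x(1) s x(2) y])
      fix d
      assume "majorizes x (y + d)" "majorizes x (y - d)" "y + d \<in> ?S" "y - d \<in> ?S"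
      hence "X + Diag d \<in> ?F s" "X - Diag d \<in> ?F s"
        using x(1) unfolding X_eq linear_add[OF linear_Diag, symmetric]
          linear_diff[OF linear_Diag, symmetric] Diag_mem_feasible_set by blast+
      hence "Diag d = 0"
        by (rule extreme_point_rigid[OF X])
      hence "diag_vec (Diag d) = diag_vec 0"
        by simp
      thus "d = 0"
        by (simp add: linear_0[OF linear_diag_vec])
    qed
    thus "rank X \<le> kt + mt"
      unfolding X_eq by (rule rank_le)
  }
  {
    assume "finite_optimal_value f kt m A bl bu"
    then obtain X s where opt: "ereal (A 0 \<bullet> X) = V_rel_I f kt m A bl bu"
      and s: "s \<in> {1..kt + 1}" and XF: "X \<in> ?F s"
      by (auto simp: finite_optimal_value_def optimal_solution_def)
    have X_eq: "X = Diag (diag_vec X)"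
      using XF by (rule feasible_set_diagonal)
    define v where "v = A 0 \<bullet> X"
    have v_le: "v \<le> ?a 0 \<bullet> z" if "Diag z \<in> ?F s" for z
    proof -
      have "V_rel_I f kt m A bl bu \<le> ereal (A 0 \<bullet> Diag z)"
        unfolding V_rel_I_def using s that by (meson INF_lower INF_lower2)
      thus ?thesis
        by (simp add: v_def inner_Diag flip: opt)
    qed
    have "Diag (diag_vec X) \<in> ?F s"
      using XF X_eq by simp
    then obtain x where x: "x \<in> window_vectors f kt s" "majorizes x (diag_vec X)"
      and slab_X: "diag_vec X \<in> ?S"
      by (auto simp: Diag_mem_feasible_set)
    \<comment> \<open>Fixing \<open>x\<close> gives compactness, which the whole set of optimal solutions may lack:
      the majorizing vectors can be unbounded.\<close>
    define Q where "Q = {y. majorizes x y} \<inter> ?S \<inter> {y. ?a 0 \<bullet> y = v}"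
    have "compact Q" "convex Q"
      unfolding Q_def
      by (intro compact_Int_closed compact_majorized closed_slab closed_hyperplane
          convex_Int convex_majorized convex_slab convex_hyperplane)+
    moreover have "diag_vec X \<in> Q"
      using x(2) slab_X X_eq inner_Diag[of "A 0" "diag_vec X"] by (simp add: Q_def v_def)
    ultimately obtain y where ext: "y extreme_point_of Q"
      using extreme_point_exists_convex[of Q] by blast
    hence y: "majorizes x y" "y \<in> ?S" "?a 0 \<bullet> y = v"
      by (auto simp: extreme_point_of_def Q_def)
    have "card {i. y $ i \<noteq> 0} \<le> kt + dim (?a ` {1..m})"
    proof (rule card_nonzero_le_if_rigid[OF x(1) s y(1,2)])
      fix d
      assume d: "majorizes x (y + d)" "majorizes x (y - d)" "y + d \<in> ?S" "y - d \<in> ?S"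
      \<comment> \<open>Neither endpoint beats the optimal value, which their midpoint attains.\<close>
      hence "v \<le> ?a 0 \<bullet> (y + d)" "v \<le> ?a 0 \<bullet> (y - d)"
        using x(1) by (auto intro!: v_le simp: Diag_mem_feasible_set)
      hence "?a 0 \<bullet> d = 0"
        using y(3) by (simp add: inner_add_right inner_diff_right)
      hence "y + d \<in> Q" "y - d \<in> Q"
        using d y(3) by (auto simp: Q_def inner_add_right inner_diff_right)
      thus "d = 0"
        by (rule extreme_point_rigid[OF ext])
    qed
    moreover have "Diag y \<in> ?F s"
      using x(1) y by (auto simp: Diag_mem_feasible_set)
    moreover have "ereal (A 0 \<bullet> Diag y) = V_rel_I f kt m A bl bu"
      using y(3) opt by (simp add: inner_Diag v_def)
    ultimately show "\<exists>X. optimal_solution f kt m A bl bu X \<and> rank X \<le> kt + mt"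
      unfolding optimal_solution_def using s rank_le by blast
  }
qed

end
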